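(* Assume $p=m$, $D=0$, and $\mathrm{rank}\begin{bmatrix} I-A & B\\ C & 0\end{bmatrix}=n+m$. Let $(X,U)$ be a minimizer of Problem 3, let $(K,H,G,F)$ be the unique solution of $\begin{bmatrix} K & H \\ G & F \end{bmatrix}\begin{bmatrix} X \\ Z \end{bmatrix} = \begin{bmatrix} U \\ V \end{bmatrix}$, assume $\det(I-(A+BK))\neq0$ and $\det(I-F)\neq0$, and set $M=\big(C(I-(A+BK))^{-1}B\big)^{-1}$, $L=-G(I-(A+BK))^{-1}BM$. Let $r(t)$ be a step reference with $r(t)=r_-$ for $t<0$ and $r(t)=r_+$ for $t\ge 0$ ($r_\pm\in\mathbb{R}^m$ constant). Then for every initial state $x_0\in\mathbb{R}^n$, the closed loop of the plant with the tracking compensator $z_r(t+1)=Fz_r(t)+Gx(t)+Lr(t)$, $u(t)=Hz_r(t)+Kx(t)+Mr(t)$, $z_r(0)=0$, satisfies $\lim_{t\to\infty}\|y(t)-r(t)\|_2=0$ (zero steady-state tracking error).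
   Context: Plant: $x(t+1)=Ax(t)+Bu(t)$, $x(0)=x_0$, $y(t)=Cx(t)$, with $x\in\mathbb{R}^n$, $u,y\in\mathbb{R}^m$, $(A,B)$ reachable, horizon $N\ge 2$. $P\in\mathbb{R}^{N\times N}$ is the nilpotent shift matrix $P=\begin{bmatrix}0 & 0\\ I_{N-1} & 0\end{bmatrix}$; $\otimes$ is the Kronecker product; $\mathrm{e}_1\in\mathbb{R}^N$; $\|W\|_1=\sum_{i,j}|w_{ij}|$. Problem 3 (minimum attention control): minimize $\|U(P\otimes I_n)-U\|_1$ over $X\in\mathbb{R}^{n\times nN}$, $U\in\mathbb{R}^{m\times nN}$ subject to $AX+BU=X(P\otimes I_n)$ and $X(\mathrm{e}_1\otimes I_n)=I_n$. $Z=\begin{bmatrix}0_{n(N-1)\times n} & I_{n(N-1)}\end{bmatrix}$, $V=Z(P\otimes I_n)$. *)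

theory Defs
  imports "Jordan_Normal_Form.DL_Rank" "Jordan_Normal_Form.Gauss_Jordan_Elimination"
begin

text \<open>Kronecker product of matrices.\<close>
definition kron :: "real mat \<Rightarrow> real mat \<Rightarrow> real mat" where
  "kron P Q = mat (dim_row P * dim_row Q) (dim_col P * dim_col Q)
     (\<lambda>(i,j). P $$ (i div dim_row Q, j div dim_col Q) * Q $$ (i mod dim_row Q, j mod dim_col Q))"

text \<open>Nilpotent shift matrix P (N x N): ones on the first subdiagonal.\<close>
definition shift_mat :: "nat \<Rightarrow> real mat" where
  "shift_mat N = mat N N (\<lambda>(i,j). if i = Suc j then 1 else 0)"

text \<open>First standard basis vector e1 of R^N, as an N x 1 matrix.\<close>
definition e1_mat :: "nat \<Rightarrow> real mat" where
  "e1_mat N = mat N 1 (\<lambda>(i,j). if i = 0 then 1 else 0)"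

text \<open>Z = [0_{n(N-1) x n}, I_{n(N-1)}].\<close>
definition Z_mat :: "nat \<Rightarrow> nat \<Rightarrow> real mat" where
  "Z_mat n N = mat (n * (N - 1)) (n * N) (\<lambda>(i,j). if j = i + n then 1 else 0)"

text \<open>Entrywise 1-norm.\<close>
definition norm1_mat :: "real mat \<Rightarrow> real" where
  "norm1_mat W = (\<Sum>i<dim_row W. \<Sum>j<dim_col W. \<bar>W $$ (i,j)\<bar>)"

text \<open>Euclidean norm of a vector.\<close>
definition norm2_vec :: "real vec \<Rightarrow> real" where
  "norm2_vec v = sqrt (\<Sum>i<dim_vec v. (v $ i)\<^sup>2)"

text \<open>Feasible set of Problem 3.\<close>
definition prob3_feasible :: "nat \<Rightarrow> nat \<Rightarrow> nat \<Rightarrow> real mat \<Rightarrow> real mat \<Rightarrow> real mat \<Rightarrow> real mat \<Rightarrow> bool" where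
  "prob3_feasible n m N A B X U \<longleftrightarrow>
     X \<in> carrier_mat n (n * N) \<and> U \<in> carrier_mat m (n * N) \<and>
     A * X + B * U = X * kron (shift_mat N) (1\<^sub>m n) \<and>
     X * kron (e1_mat N) (1\<^sub>m n) = 1\<^sub>m n"

text \<open>Objective of Problem 3.\<close>
definition prob3_cost :: "nat \<Rightarrow> nat \<Rightarrow> real mat \<Rightarrow> real" where
  "prob3_cost n N U = norm1_mat (U * kron (shift_mat N) (1\<^sub>m n) - U)"

definition prob3_minimizer :: "nat \<Rightarrow> nat \<Rightarrow> nat \<Rightarrow> real mat \<Rightarrow> real mat \<Rightarrow> real mat \<Rightarrow> real mat \<Rightarrow> bool" where
  "prob3_minimizer n m N A B X U \<longleftrightarrow>
     prob3_feasible n m N A B X U \<and>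
     (\<forall>X' U'. prob3_feasible n m N A B X' U' \<longrightarrow> prob3_cost n N U \<le> prob3_cost n N U')"

text \<open>Reachability matrix [B, AB, ..., A^(n-1) B] and reachability of (A,B).\<close>
definition reach_mat :: "nat \<Rightarrow> nat \<Rightarrow> real mat \<Rightarrow> real mat \<Rightarrow> real mat" where
  "reach_mat n m A B = mat n (n * m) (\<lambda>(i,j). ((A ^\<^sub>m (j div m)) * B) $$ (i, j mod m))"

definition reachable :: "nat \<Rightarrow> nat \<Rightarrow> real mat \<Rightarrow> real mat \<Rightarrow> bool" where
  "reachable n m A B \<longleftrightarrow> vec_space.rank n (reach_mat n m A B) = n"

text \<open>Matrix inverse (the library's Gauss-Jordan inverse).\<close>
definition minv :: "real mat \<Rightarrow> real mat" where
  "minv A = the (mat_inverse A)"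

end

theory Submission
  imports Defs
begin

text \<open>
  Put \<open>S = P \<otimes> I\<^sub>n\<close> and \<open>Q = I - (A + BK)\<close>. The rank condition makes \<open>C Q\<^sup>-\<^sup>1 B\<close> invertible
  (a Schur complement of the nonsingular block matrix), so \<open>x\<^sub>s = Q\<^sup>-\<^sup>1 B M r\<close> is an equilibrium
  of the closed loop with \<open>C x\<^sub>s = r\<close>, and \<open>L r = -G x\<^sub>s\<close>. The constraints of Problem 3 together
  with \<open>[K H; G F] [X; Z] = [U; V]\<close> say that the closed loop maps a state of the form
  \<open>(x, z) = (X c + x\<^sub>s, Z c)\<close> to \<open>(X (S c) + x\<^sub>s, Z (S c))\<close>. The initial state is of this form
  with \<open>c = (e\<^sub>1 \<otimes> I\<^sub>n) (x\<^sub>0 - x\<^sub>s)\<close>, and \<open>S\<close> shifts blocks of length \<open>n\<close> down, so \<open>S\<^sup>N = 0\<close>: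
  from time \<open>N\<close> on, \<open>x(t) = x\<^sub>s\<close> and the tracking error is exactly zero. Only feasibility of
  \<open>(X, U)\<close> is used.
\<close>

lemma kron_shift_mat_carrier: "kron (shift_mat N) (1\<^sub>m n) \<in> carrier_mat (n * N) (n * N)"
  by (simp add: kron_def shift_mat_def mult.commute)

lemma kron_e1_mat_carrier: "kron (e1_mat N) (1\<^sub>m n) \<in> carrier_mat (n * N) n"
  by (simp add: kron_def e1_mat_def mult.commute)

lemma kron_shift_mat_index:
  assumes i: "i < n * N" and j: "j < n * N"
  shows "kron (shift_mat N) (1\<^sub>m n) $$ (i, j) = (if i = j + n then 1 else 0)"
proof -
  have n: "n > 0"
    using i by (cases n) auto
  have "i div n < N" "j div n < N"
    using i j by (simp_all add: less_mult_imp_div_less mult.commute)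
  moreover have "i div n = Suc (j div n) \<and> i mod n = j mod n \<longleftrightarrow> i = j + n"
    using n by (metis add.commute div_mult_mod_eq mod_add_self2 div_add_self2
        less_not_refl2 plus_1_eq_Suc)
  ultimately show ?thesis
    using i j n by (auto simp: kron_def shift_mat_def mult.commute)
qed

lemma kron_e1_mat_index:
  assumes i: "i < n * N" and j: "j < n"
  shows "kron (e1_mat N) (1\<^sub>m n) $$ (i, j) = (if i = j then 1 else 0)"
proof -
  have "i div n < N"
    using i by (simp add: less_mult_imp_div_less mult.commute)
  moreover have "i div n = 0 \<and> i mod n = j \<longleftrightarrow> i = j"
    using j by (auto simp: div_eq_0_iff)
  ultimately show ?thesis
    using i j by (auto simp: kron_def e1_mat_def mult.commute)
qed

lemma kron_shift_mat_mult_vec_index: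
  assumes c: "c \<in> carrier_vec (n * N)" and i: "i < n * N"
  shows "(kron (shift_mat N) (1\<^sub>m n) *\<^sub>v c) $ i = (if n \<le> i then c $ (i - n) else 0)"
proof -
  have "(kron (shift_mat N) (1\<^sub>m n) *\<^sub>v c) $ i
      = (\<Sum>j<n * N. kron (shift_mat N) (1\<^sub>m n) $$ (i, j) * c $ j)"
    using kron_shift_mat_carrier[of N n] c i by (simp add: scalar_prod_def lessThan_atLeast0)
  also have "\<dots> = (\<Sum>j<n * N. if j = i - n \<and> n \<le> i then c $ j else 0)"
    by (rule sum.cong) (auto simp: kron_shift_mat_index i)
  also have "\<dots> = (if n \<le> i then c $ (i - n) else 0)"
    using i by auto
  finally show ?thesis .
qed

lemma kron_shift_mat_iterate_carrier:
  assumes "c \<in> carrier_vec (n * N)"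
  shows "((*\<^sub>v) (kron (shift_mat N) (1\<^sub>m n)) ^^ t) c \<in> carrier_vec (n * N)"
  by (induction t) (auto intro: mult_mat_vec_carrier[OF kron_shift_mat_carrier] assms)

lemma kron_shift_mat_iterate_index:
  assumes c: "c \<in> carrier_vec (n * N)" and i: "i < n * N"
  shows "(((*\<^sub>v) (kron (shift_mat N) (1\<^sub>m n)) ^^ t) c) $ i
    = (if t * n \<le> i then c $ (i - t * n) else 0)"
  using i
proof (induction t arbitrary: i)
  case (Suc t)
  show ?case
    using kron_shift_mat_iterate_carrier[OF c, of t] Suc.IH[of "i - n"] Suc.prems
    by (auto simp: kron_shift_mat_mult_vec_index)
qed simp

lemma kron_shift_mat_iterate_nilpotent:
  assumes c: "c \<in> carrier_vec (n * N)" and t: "N \<le> t"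
  shows "((*\<^sub>v) (kron (shift_mat N) (1\<^sub>m n)) ^^ t) c = 0\<^sub>v (n * N)"
proof (rule eq_vecI)
  show "dim_vec (((*\<^sub>v) (kron (shift_mat N) (1\<^sub>m n)) ^^ t) c) = dim_vec (0\<^sub>v (n * N))"
    using kron_shift_mat_iterate_carrier[OF c] by simp
  fix i assume i: "i < dim_vec (0\<^sub>v (n * N) :: real vec)"
  have "i < n * t"
    using less_le_trans[OF _ mult_le_mono2[OF t]] i by simp
  then show "(((*\<^sub>v) (kron (shift_mat N) (1\<^sub>m n)) ^^ t) c) $ i = 0\<^sub>v (n * N) $ i"
    using kron_shift_mat_iterate_index[OF c, of i t] i by (simp add: mult.commute)
qed

lemma Z_mat_mult_kron_e1_mat: "Z_mat n N * kron (e1_mat N) (1\<^sub>m n) = 0\<^sub>m (n * (N - 1)) n"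
proof (rule eq_matI)
  fix i j assume "i < dim_row (0\<^sub>m (n * (N - 1)) n :: real mat)" "j < dim_col (0\<^sub>m (n * (N - 1)) n :: real mat)"
  then have i: "i < n * (N - 1)" and j: "j < n"
    by auto
  have "(Z_mat n N * kron (e1_mat N) (1\<^sub>m n)) $$ (i, j)
      = (\<Sum>k<n * N. Z_mat n N $$ (i, k) * kron (e1_mat N) (1\<^sub>m n) $$ (k, j))"
    using kron_e1_mat_carrier[of N n] i j by (simp add: Z_mat_def scalar_prod_def lessThan_atLeast0)
  also have "\<dots> = 0"
    using i j by (intro sum.neutral) (auto simp: Z_mat_def kron_e1_mat_index)
  finally show "(Z_mat n N * kron (e1_mat N) (1\<^sub>m n)) $$ (i, j) = 0\<^sub>m (n * (N - 1)) n $$ (i, j)"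
    using i j by simp
qed (auto simp: Z_mat_def kron_e1_mat_carrier[THEN carrier_matD(2)])

lemma Z_mat_mult_kron_e1_mat_vec:
  assumes d: "d \<in> carrier_vec n"
  shows "Z_mat n N *\<^sub>v (kron (e1_mat N) (1\<^sub>m n) *\<^sub>v d) = 0\<^sub>v (n * (N - 1))"
proof -
  have "Z_mat n N *\<^sub>v (kron (e1_mat N) (1\<^sub>m n) *\<^sub>v d) = (Z_mat n N * kron (e1_mat N) (1\<^sub>m n)) *\<^sub>v d"
    using assoc_mult_mat_vec[OF _ kron_e1_mat_carrier d, of "Z_mat n N" "n * (N - 1)" N]
    by (simp add: Z_mat_def)
  then show ?thesis
    using d by (auto simp: Z_mat_mult_kron_e1_mat)
qed

lemma mult_mat_vec_zero:
  assumes "X \<in> carrier_mat k l"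
  shows "X *\<^sub>v 0\<^sub>v l = 0\<^sub>v k"
  using assms by (intro eq_vecI) auto

lemma det_four_block_mat_schur:
  fixes Q B C W :: "'a :: idom mat"
  assumes Q: "Q \<in> carrier_mat n n" and B: "B \<in> carrier_mat n m" and C: "C \<in> carrier_mat m n"
    and W: "W \<in> carrier_mat n n" and QW: "Q * W = 1\<^sub>m n"
  shows "det (four_block_mat Q B C (0\<^sub>m m m)) = det Q * det (- (C * W * B))"
proof -
  have QWB: "Q * (W * B) = B"
    using assms by (metis assoc_mult_mat left_mult_one_mat)
  have "four_block_mat Q B C (0\<^sub>m m m) * four_block_mat (1\<^sub>m n) (- (W * B)) (0\<^sub>m m n) (1\<^sub>m m)
      = four_block_mat Q (0\<^sub>m n m) C (- (C * W * B))"
    using assms QWB by (subst mult_four_block_mat) (auto simp: assoc_mult_mat[of C n n W n])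
  then have "det (four_block_mat Q B C (0\<^sub>m m m)) * det (four_block_mat (1\<^sub>m n) (- (W * B)) (0\<^sub>m m n) (1\<^sub>m m))
      = det (four_block_mat Q (0\<^sub>m n m) C (- (C * W * B)))"
    using assms by (subst det_mult[symmetric]) auto
  moreover have "det (four_block_mat (1\<^sub>m n) (- (W * B)) (0\<^sub>m m n) (1\<^sub>m m)) = 1"
    using assms by (subst det_four_block_mat_lower_left_zero) auto
  ultimately show ?thesis
    using assms by (simp add: det_four_block_mat_upper_right_zero)
qed

lemma det_transfer_mat_nonzero:
  fixes A B C K W :: "'a :: field mat"
  assumes A: "A \<in> carrier_mat n n" and B: "B \<in> carrier_mat n m" and C: "C \<in> carrier_mat m n"
    and K: "K \<in> carrier_mat m n" and W: "W \<in> carrier_mat n n"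
    and QW: "(1\<^sub>m n - (A + B * K)) * W = 1\<^sub>m n"
    and rank: "vec_space.rank (n + m) (four_block_mat (1\<^sub>m n - A) B C (0\<^sub>m m m)) = n + m"
  shows "det (C * W * B) \<noteq> 0"
proof -
  let ?T = "four_block_mat (1\<^sub>m n - A) B C (0\<^sub>m m m)"
  let ?R = "four_block_mat (1\<^sub>m n) (0\<^sub>m n m) (- K) (1\<^sub>m m)"
  have Q: "1\<^sub>m n - (A + B * K) \<in> carrier_mat n n"
    using assms by auto
  have "?T \<in> carrier_mat (n + m) (n + m)"
    using assms by auto
  then have "det ?T \<noteq> 0"
    using vec_space.det_rank_iff rank by auto
  moreover have "det ?R = 1"
    using assms by (subst det_four_block_mat_upper_right_zero) auto
  moreover have "?T * ?R = four_block_mat (1\<^sub>m n - (A + B * K)) B C (0\<^sub>m m m)"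
    using assms by (subst mult_four_block_mat) auto
  then have "det ?T * det ?R = det (1\<^sub>m n - (A + B * K)) * det (- (C * W * B))"
    using assms det_four_block_mat_schur[OF Q B C W QW] by (subst det_mult[symmetric]) auto
  ultimately have "det (- (C * W * B)) \<noteq> 0"
    by auto
  then show ?thesis
    using det_0_negate[of "C * W * B" m] assms by auto
qed

lemma minv_inverse:
  assumes Q: "Q \<in> carrier_mat k k" and d: "det Q \<noteq> 0"
  shows "Q * minv Q = 1\<^sub>m k" "minv Q * Q = 1\<^sub>m k" "minv Q \<in> carrier_mat k k"
proof -
  obtain W where "mat_inverse Q = Some W"
    using mat_inverse(1)[OF Q, of "()"] det_non_zero_imp_unit[OF Q d, of "()"] by (cases "mat_inverse Q") auto
  with mat_inverse(2)[OF Q] show "Q * minv Q = 1\<^sub>m k" "minv Q * Q = 1\<^sub>m k" "minv Q \<in> carrier_mat k k"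
    by (auto simp: minv_def)
qed

lemma mult_mat_vec_right_inverse:
  fixes X E :: "'a :: semiring_1 mat"
  assumes X: "X \<in> carrier_mat k l" and E: "E \<in> carrier_mat l k" and XE: "X * E = 1\<^sub>m k"
    and d: "d \<in> carrier_vec k"
  shows "X *\<^sub>v (E *\<^sub>v d) = d"
proof -
  have "X *\<^sub>v (E *\<^sub>v d) = (X * E) *\<^sub>v d"
    using assoc_mult_mat_vec[OF X E d] by simp
  then show ?thesis
    using d by (simp add: XE)
qed

lemma tracking_steady_state:
  fixes A B C K G M L :: "real mat" and r :: "real vec"
  assumes A: "A \<in> carrier_mat n n" and B: "B \<in> carrier_mat n m" and C: "C \<in> carrier_mat m n"
    and K: "K \<in> carrier_mat m n" and G: "G \<in> carrier_mat q n" and r: "r \<in> carrier_vec m"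
    and det: "det (1\<^sub>m n - (A + B * K)) \<noteq> 0"
    and rank: "vec_space.rank (n + m) (four_block_mat (1\<^sub>m n - A) B C (0\<^sub>m m m)) = n + m"
    and M_eq: "M = minv (C * minv (1\<^sub>m n - (A + B * K)) * B)"
    and L_eq: "L = - (G * minv (1\<^sub>m n - (A + B * K)) * B * M)"
  defines "xs \<equiv> minv (1\<^sub>m n - (A + B * K)) *\<^sub>v (B *\<^sub>v (M *\<^sub>v r))"
  shows "M \<in> carrier_mat m m" and "xs \<in> carrier_vec n" and "C *\<^sub>v xs = r"
    and "A *\<^sub>v xs + B *\<^sub>v (K *\<^sub>v xs + M *\<^sub>v r) = xs" and "L *\<^sub>v r = - (G *\<^sub>v xs)"
proof -
  define W where "W = minv (1\<^sub>m n - (A + B * K))"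
  have Q: "1\<^sub>m n - (A + B * K) \<in> carrier_mat n n"
    using A B K by auto
  then have QW: "(1\<^sub>m n - (A + B * K)) * W = 1\<^sub>m n" and W: "W \<in> carrier_mat n n"
    using minv_inverse[OF Q det] by (auto simp: W_def)
  then have "det (C * W * B) \<noteq> 0"
    using det_transfer_mat_nonzero[OF A B C K W QW rank] by simp
  then have CWBM: "C * W * B * M = 1\<^sub>m m" and M: "M \<in> carrier_mat m m"
    using minv_inverse[of "C * W * B" m] B C W by (auto simp: M_eq W_def)
  show "M \<in> carrier_mat m m"
    by (fact M)
  show xs: "xs \<in> carrier_vec n"
    using B M W r by (simp add: xs_def W_def[symmetric])
  have through_xs: "(D * W * B * M) *\<^sub>v r = D *\<^sub>v xs" if D: "D \<in> carrier_mat k n" for D :: "real mat" and k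
    using D B W M r unfolding xs_def W_def[symmetric]
    by (simp add: assoc_mult_mat_vec[of _ k n _ n] assoc_mult_mat_vec[of _ k n _ m]
        assoc_mult_mat_vec[of _ k m _ m])
  show "C *\<^sub>v xs = r"
    using through_xs[OF C] CWBM r by simp
  show "L *\<^sub>v r = - (G *\<^sub>v xs)"
    using through_xs[OF G] G W B M r by (simp add: L_eq W_def[symmetric])
  have "(1\<^sub>m n - (A + B * K)) *\<^sub>v xs = B *\<^sub>v (M *\<^sub>v r)"
    using Q B W M r QW unfolding xs_def W_def[symmetric]
    by (subst assoc_mult_mat_vec[symmetric, of _ n n _ n]) auto
  then have BMr: "B *\<^sub>v (M *\<^sub>v r) = xs - (A *\<^sub>v xs + B *\<^sub>v (K *\<^sub>v xs))"
    using A B K xs by (simp add: minus_mult_distrib_mat_vec[of _ n n] add_mult_distrib_mat_vec[of _ n n])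
  show "A *\<^sub>v xs + B *\<^sub>v (K *\<^sub>v xs + M *\<^sub>v r) = xs"
    using A B K M r xs by (simp add: mult_add_distrib_mat_vec[of B n m] BMr) (intro eq_vecI; simp)
qed

lemma closed_loop_step:
  fixes A B X U S K H G F Z :: "real mat" and c xs v w :: "real vec"
  assumes A: "A \<in> carrier_mat n n" and B: "B \<in> carrier_mat n m"
    and X: "X \<in> carrier_mat n p" and U: "U \<in> carrier_mat m p" and S: "S \<in> carrier_mat p p"
    and K: "K \<in> carrier_mat m n" and H: "H \<in> carrier_mat m q"
    and G: "G \<in> carrier_mat q n" and F: "F \<in> carrier_mat q q" and Z: "Z \<in> carrier_mat q p"
    and c: "c \<in> carrier_vec p" and xs: "xs \<in> carrier_vec n" and v: "v \<in> carrier_vec m"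
    and XS: "A * X + B * U = X * S" and KH: "K * X + H * Z = U" and ZS: "G * X + F * Z = Z * S"
    and steady: "A *\<^sub>v xs + B *\<^sub>v (K *\<^sub>v xs + v) = xs" and w: "w = - (G *\<^sub>v xs)"
  shows "A *\<^sub>v (X *\<^sub>v c + xs) + B *\<^sub>v (H *\<^sub>v (Z *\<^sub>v c) + K *\<^sub>v (X *\<^sub>v c + xs) + v)
      = X *\<^sub>v (S *\<^sub>v c) + xs"
    and "F *\<^sub>v (Z *\<^sub>v c) + G *\<^sub>v (X *\<^sub>v c + xs) + w = Z *\<^sub>v (S *\<^sub>v c)"
proof -
  have Xc: "X *\<^sub>v c \<in> carrier_vec n" and Zc: "Z *\<^sub>v c \<in> carrier_vec q"
    using X Z c by auto
  have "X *\<^sub>v (S *\<^sub>v c) = (A * X + B * U) *\<^sub>v c"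
    using X S c by (simp add: XS)
  also have "\<dots> = A *\<^sub>v (X *\<^sub>v c) + B *\<^sub>v (U *\<^sub>v c)"
    using A B X U c by (simp add: add_mult_distrib_mat_vec[of _ n p])
  also have "U *\<^sub>v c = K *\<^sub>v (X *\<^sub>v c) + H *\<^sub>v (Z *\<^sub>v c)"
    using K H X Z c by (simp add: KH[symmetric] add_mult_distrib_mat_vec[of _ m p])
  finally have XSc: "X *\<^sub>v (S *\<^sub>v c) = A *\<^sub>v (X *\<^sub>v c) + (B *\<^sub>v (K *\<^sub>v (X *\<^sub>v c)) + B *\<^sub>v (H *\<^sub>v (Z *\<^sub>v c)))"
    using B K H Xc Zc by (simp add: mult_add_distrib_mat_vec[of _ n m])
  have "Z *\<^sub>v (S *\<^sub>v c) = (G * X + F * Z) *\<^sub>v c"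
    using Z S c by (simp add: ZS)
  also have "\<dots> = G *\<^sub>v (X *\<^sub>v c) + F *\<^sub>v (Z *\<^sub>v c)"
    using G F X Z c by (simp add: add_mult_distrib_mat_vec[of _ q p])
  finally show "F *\<^sub>v (Z *\<^sub>v c) + G *\<^sub>v (X *\<^sub>v c + xs) + w = Z *\<^sub>v (S *\<^sub>v c)"
    using G F Xc Zc xs by (simp add: w mult_add_distrib_mat_vec[of _ q n]) (intro eq_vecI; simp)
  have "A *\<^sub>v (X *\<^sub>v c + xs) + B *\<^sub>v (H *\<^sub>v (Z *\<^sub>v c) + K *\<^sub>v (X *\<^sub>v c + xs) + v)
      = A *\<^sub>v (X *\<^sub>v c) + (B *\<^sub>v (K *\<^sub>v (X *\<^sub>v c)) + B *\<^sub>v (H *\<^sub>v (Z *\<^sub>v c)))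
        + (A *\<^sub>v xs + B *\<^sub>v (K *\<^sub>v xs + v))"
    using A B K H Xc Zc xs v
    by (simp add: mult_add_distrib_mat_vec[of _ n n] mult_add_distrib_mat_vec[of _ n m]
        mult_add_distrib_mat_vec[of _ m n]) (intro eq_vecI; simp)
  then show "A *\<^sub>v (X *\<^sub>v c + xs) + B *\<^sub>v (H *\<^sub>v (Z *\<^sub>v c) + K *\<^sub>v (X *\<^sub>v c + xs) + v)
      = X *\<^sub>v (S *\<^sub>v c) + xs"
    by (simp only: steady XSc)
qed

lemma closed_loop_trajectory:
  fixes A B X U S K H G F Z :: "real mat" and c0 xs v w :: "real vec"
    and x z :: "nat \<Rightarrow> real vec"
  assumes A: "A \<in> carrier_mat n n" and B: "B \<in> carrier_mat n m"
    and X: "X \<in> carrier_mat n p" and U: "U \<in> carrier_mat m p" and S: "S \<in> carrier_mat p p"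
    and K: "K \<in> carrier_mat m n" and H: "H \<in> carrier_mat m q"
    and G: "G \<in> carrier_mat q n" and F: "F \<in> carrier_mat q q" and Z: "Z \<in> carrier_mat q p"
    and c0: "c0 \<in> carrier_vec p" and xs: "xs \<in> carrier_vec n" and v: "v \<in> carrier_vec m"
    and XS: "A * X + B * U = X * S" and KH: "K * X + H * Z = U" and ZS: "G * X + F * Z = Z * S"
    and steady: "A *\<^sub>v xs + B *\<^sub>v (K *\<^sub>v xs + v) = xs" and w: "w = - (G *\<^sub>v xs)"
    and x0: "x 0 = X *\<^sub>v c0 + xs" and z0: "z 0 = Z *\<^sub>v c0"
    and x_step: "\<And>t. x (Suc t) = A *\<^sub>v x t + B *\<^sub>v (H *\<^sub>v z t + K *\<^sub>v x t + v)"
    and z_step: "\<And>t. z (Suc t) = F *\<^sub>v z t + G *\<^sub>v x t + w"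
  shows "x t = X *\<^sub>v (((*\<^sub>v) S ^^ t) c0) + xs \<and> z t = Z *\<^sub>v (((*\<^sub>v) S ^^ t) c0)"
proof (induction t)
  case (Suc t)
  have "((*\<^sub>v) S ^^ t) c0 \<in> carrier_vec p"
    by (induction t) (use S c0 in auto)
  with Suc.IH closed_loop_step[OF A B X U S K H G F Z _ xs v XS KH ZS steady w] show ?case
    by (simp add: x_step z_step)
qed (simp add: x0 z0)

theorem proposition1:
  fixes n m N :: nat
    and A B C X U K H G F M L :: "real mat"
    and r_plus x0 :: "real vec"
    and x zr :: "nat \<Rightarrow> real vec"
    and u y :: "nat \<Rightarrow> real vec"
  assumes dims: "A \<in> carrier_mat n n" "B \<in> carrier_mat n m" "C \<in> carrier_mat m n"
    and N2: "N \<ge> 2"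
    and reach: "reachable n m A B"
    and rank: "vec_space.rank (n + m) (four_block_mat (1\<^sub>m n - A) B C (0\<^sub>m m m)) = n + m"
    and minim: "prob3_minimizer n m N A B X U"
    and KHGF_dims: "K \<in> carrier_mat m n" "H \<in> carrier_mat m (n * (N - 1))"
       "G \<in> carrier_mat (n * (N - 1)) n" "F \<in> carrier_mat (n * (N - 1)) (n * (N - 1))"
    and KHGF_eq1: "K * X + H * Z_mat n N = U"
    and KHGF_eq2: "G * X + F * Z_mat n N = Z_mat n N * kron (shift_mat N) (1\<^sub>m n)"
    and det1: "det (1\<^sub>m n - (A + B * K)) \<noteq> 0"
    and det2: "det (1\<^sub>m (n * (N - 1)) - F) \<noteq> 0"
    and M_eq: "M = minv (C * minv (1\<^sub>m n - (A + B * K)) * B)"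
    and L_eq: "L = - (G * minv (1\<^sub>m n - (A + B * K)) * B * M)"
    and r_dim: "r_plus \<in> carrier_vec m"
    and x0_dim: "x0 \<in> carrier_vec n"
    and x_init: "x 0 = x0"
    and zr_init: "zr 0 = 0\<^sub>v (n * (N - 1))"
    and plant: "\<And>t. x (Suc t) = A *\<^sub>v x t + B *\<^sub>v u t"
    and outp: "\<And>t. y t = C *\<^sub>v x t"
    and comp_z: "\<And>t. zr (Suc t) = F *\<^sub>v zr t + G *\<^sub>v x t + L *\<^sub>v r_plus"
    and comp_u: "\<And>t. u t = H *\<^sub>v zr t + K *\<^sub>v x t + M *\<^sub>v r_plus"
  shows "(\<lambda>t. norm2_vec (y t - r_plus)) \<longlonglongrightarrow> 0"
proof -
  let ?S = "kron (shift_mat N) (1\<^sub>m n)" and ?E = "kron (e1_mat N) (1\<^sub>m n)"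
  from minim have X: "X \<in> carrier_mat n (n * N)" and U: "U \<in> carrier_mat m (n * N)"
    and XS: "A * X + B * U = X * ?S" and XE: "X * ?E = 1\<^sub>m n"
    unfolding prob3_minimizer_def prob3_feasible_def by auto
  define xs where "xs = minv (1\<^sub>m n - (A + B * K)) *\<^sub>v (B *\<^sub>v (M *\<^sub>v r_plus))"
  note steady = tracking_steady_state[OF dims KHGF_dims(1,3) r_dim det1 rank M_eq L_eq, folded xs_def]
  define c0 where "c0 = ?E *\<^sub>v (x0 - xs)"
  have d0: "x0 - xs \<in> carrier_vec n"
    using x0_dim steady(2) by simp
  then have c0: "c0 \<in> carrier_vec (n * N)"
    using mult_mat_vec_carrier[OF kron_e1_mat_carrier] by (simp add: c0_def)
  have Z: "Z_mat n N \<in> carrier_mat (n * (N - 1)) (n * N)"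
    by (simp add: Z_mat_def)
  have "x 0 = X *\<^sub>v c0 + xs" and "zr 0 = Z_mat n N *\<^sub>v c0"
    using mult_mat_vec_right_inverse[OF X kron_e1_mat_carrier XE d0] Z_mat_mult_kron_e1_mat_vec[OF d0]
      x0_dim steady(2) by (auto simp: c0_def x_init zr_init)
  then have "x t = X *\<^sub>v ((((*\<^sub>v) ?S) ^^ t) c0) + xs" for t
    using closed_loop_trajectory[OF dims(1,2) X U kron_shift_mat_carrier KHGF_dims Z c0 steady(2)
        _ XS KHGF_eq1 KHGF_eq2 steady(4,5)] comp_z steady(1) r_dim by (simp add: plant comp_u)
  then have "y t = r_plus" if "N \<le> t" for t
    using kron_shift_mat_iterate_nilpotent[OF c0 that] mult_mat_vec_zero[OF X] steady(2,3)
    by (simp add: outp)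
  then show ?thesis
    by (intro tendsto_eventually) (auto simp: eventually_sequentially norm2_vec_def intro!: exI[of _ N])
qed

end
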